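(* Let $X,X_1,\ldots,X_n$ be i.i.d. real random variables, and let $a=(a_1,\ldots,a_n)\in\mathbf{R}^n$ with $\|a\|=1$. Let $L>0$ and $D>0$, and assume that $$\|ta-m\|\ge f_L(t)\quad\text{for all } m\in\mathbf{Z}^n \text{ and all } t\in\Big[\frac{1}{2\|a\|_\infty},D\Big].$$ If $L^2\ge 1/M(1)$, then $$Q\Big(F_a,\frac1D\Big)\le \frac{c}{D\sqrt{M(1)}},$$ where $c>0$ is an absolute constant.
   Context: For $x\in\mathbf{R}^n$, $\|x\|^2=x_1^2+\dots+x_n^2$ and $\|x\|_\infty=\max_j|x_j|$. $F_a$ denotes the distribution of $S_a=\sum_{k=1}^n a_kX_k$. For a distribution $F$ on $\mathbf{R}$, the Lévy concentration function is $Q(F,\lambda)=\sup_{x\in\mathbf{R}}F\{[x,x+\lambda]\}$, $\lambda>0$. Let $\widetilde X=X_1-X_2$ and $M(\tau)=\mathbf{E}\min\{\widetilde X^2/\tau^2,1\}$ for $\tau>0$ (the condition $L^2\ge 1/M(1)$ includes $M(1)>0$). The function $f_L$ is defined by $f_L(t)=t/6$ for $0<t<eL$ and $f_L(t)=L\sqrt{\log(t/L)}$ for $t\ge eL$. *)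

theory Defs
  imports "HOL-Probability.Probability"
begin

definition supnorm :: "nat \<Rightarrow> (nat \<Rightarrow> real) \<Rightarrow> real" where
  "supnorm n a = Max ((\<lambda>k. \<bar>a k\<bar>) ` {..<n})"

definition eucl_norm :: "nat \<Rightarrow> (nat \<Rightarrow> real) \<Rightarrow> real" where
  "eucl_norm n a = sqrt (\<Sum>k<n. (a k)\<^sup>2)"

definition fL :: "real \<Rightarrow> real \<Rightarrow> real" where
  "fL L t = (if t < exp 1 * L then t / 6 else L * sqrt (ln (t / L)))"

definition Qconc :: "real measure \<Rightarrow> real \<Rightarrow> real" where
  "Qconc F lam = (SUP x. measure F {x..x + lam})"

definition law_S :: "nat \<Rightarrow> (nat \<Rightarrow> real) \<Rightarrow> real measure \<Rightarrow> real measure" where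
  "law_S n a P = distr (PiM {..<n} (\<lambda>_. P)) borel (\<lambda>x. \<Sum>k<n. a k * x k)"

definition law_sym :: "real measure \<Rightarrow> real measure" where
  "law_sym P = distr (P \<Otimes>\<^sub>M P) borel (\<lambda>(x, y). x - y)"

definition Mfun :: "real measure \<Rightarrow> real \<Rightarrow> real" where
  "Mfun P tau = (\<integral>z. min (z\<^sup>2 / tau\<^sup>2) 1 \<partial>(law_sym P))"

end

theory Submission
  imports Defs
begin

text \<open>
  An Esseen-type inequality bounds the concentration function by an average of
  \<open>|\<phi>(t D)|\<close> over \<open>0 \<le> t \<le> 1\<close>, where \<open>\<phi>\<close> is the characteristic function of the weighted
  sum, and \<open>|\<phi>(s)| \<le> exp (- E g(s Z) / 2)\<close> for the symmetrised variable \<open>Z\<close> and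
  \<open>g(s) = \<Sum>\<^sub>k (1 - cos (a\<^sub>k s))\<close>. Jensen's inequality for the probability weight
  \<open>min (Z\<^sup>2) 1 / M\<close> moves the expectation out of the exponential, so that it remains to
  bound, uniformly in a fixed \<open>z \<noteq> 0\<close>, the average over \<open>t\<close> of
  \<open>exp (- M g(t D z) / (2 min (z\<^sup>2) 1))\<close>.

  For \<open>|z| \<le> 1\<close> the argument \<open>t D z / (2 \<pi>)\<close> stays below \<open>D\<close>, and since \<open>g(2 \<pi> u)\<close> dominates the
  squared distance of \<open>u a\<close> to the integer lattice, the hypothesis gives a pointwise Lorentzian
  bound. For \<open>|z| \<ge> 1\<close> the integrand is a function with nonnegative cosine
  coefficients, and for such functions the average at scale \<open>z\<close> is at most a constant times the
  average at scale 1.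
\<close>

section \<open>The quadratic weight and its cosine transform\<close>

text \<open>
  Unlike the triangular weight, whose cosine transform has zeros, the weight \<open>(1 - t)\<^sup>2\<close> has a
  positive cosine transform of exact order \<open>min 1 (1 / y\<^sup>2)\<close>; this makes \<open>kern_cos_scale\<close> possible.
\<close>

definition kern :: "real measure" where
  "kern = density lborel (\<lambda>t. ennreal (indicator {0..1} t * (1 - t)\<^sup>2))"

lemma sets_kern [measurable_cong, simp]: "sets kern = sets borel"
  by (simp add: kern_def)

lemma space_kern [simp]: "space kern = UNIV"
  by (simp add: kern_def)

lemma integral_kern:
  fixes f :: "real \<Rightarrow> real"
  assumes [measurable]: "f \<in> borel_measurable borel"
  shows "(\<integral>t. f t \<partial>kern) = (\<integral>t. indicator {0..1} t *\<^sub>R ((1 - t)\<^sup>2 * f t) \<partial>lborel)"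
  unfolding kern_def
  by (subst integral_density) (auto simp: mult_ac intro!: Bochner_Integration.integral_cong)

lemma AE_kern: "AE t in kern. 0 \<le> t \<and> t \<le> 1"
  unfolding kern_def by (subst AE_density) (auto simp: indicator_def)

lemma finite_measure_kern: "finite_measure kern"
proof
  have "emeasure kern (space kern) = (\<integral>\<^sup>+t. ennreal ((1 - t)\<^sup>2) * indicator {0..1} t \<partial>lborel)"
    unfolding kern_def
    by (subst emeasure_density)
       (auto intro!: nn_integral_cong simp: indicator_def)
  also have "\<dots> \<le> (\<integral>\<^sup>+t. indicator {0..1} (t::real) \<partial>lborel)"
    by (intro nn_integral_mono) (auto simp: indicator_def power_le_one)
  also have "\<dots> < \<infinity>"
    by simp
  finally show "emeasure kern (space kern) \<noteq> \<infinity>" by auto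
qed

interpretation kern: finite_measure kern
  by (rule finite_measure_kern)

lemma integrable_kern_bounded:
  fixes f :: "real \<Rightarrow> real"
  assumes "f \<in> borel_measurable borel" "\<And>t. \<bar>f t\<bar> \<le> B"
  shows "integrable kern f"
  using assms by (intro kern.integrable_const_bound[of _ B]) auto

lemma kern_cos:
  assumes "y \<noteq> 0"
  shows "(\<integral>t. cos (t * y) \<partial>kern) = 2 * (y - sin y) / y ^ 3"
proof -
  \<comment> \<open>This antiderivative of \<open>(1 - t)\<^sup>2 * cos (t * y)\<close> comes from
    integrating by parts until the polynomial factor is exhausted.\<close>
  let ?F = "\<lambda>t. (1 - t)\<^sup>2 * sin (t * y) / y - 2 * (1 - t) * cos (t * y) / y\<^sup>2 - 2 * sin (t * y) / y ^ 3"
  have "(\<integral>t. cos (t * y) \<partial>kern) = (\<integral>t. indicator {0..1} t *\<^sub>R ((1 - t)\<^sup>2 * cos (t * y)) \<partial>lborel)"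
    by (rule integral_kern) simp
  also have "\<dots> = ?F 1 - ?F 0"
  proof (rule integral_FTC_Icc)
    fix t :: real
    show "(?F has_vector_derivative (1 - t)\<^sup>2 * cos (t * y)) (at t within {0..1})"
      unfolding has_real_derivative_iff_has_vector_derivative[symmetric]
      using assms by (auto intro!: derivative_eq_intros simp: field_simps power2_eq_square power3_eq_cube)
  qed (auto intro!: continuous_intros)
  also have "\<dots> = 2 * (y - sin y) / y ^ 3"
    using assms by (simp add: field_simps power2_eq_square power3_eq_cube)
  finally show ?thesis .
qed

lemma kern_cos_abs: "(\<integral>t. cos (t * \<bar>y\<bar>) \<partial>kern) = (\<integral>t. cos (t * y) \<partial>kern)"
  by (rule Bochner_Integration.integral_cong) (auto simp: abs_if)

lemma kern_mass: "(\<integral>t. 1 \<partial>kern) = (1/3 :: real)"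
proof -
  have "(\<integral>t. 1 \<partial>kern) = (\<integral>t. indicator {0..1} (t::real) *\<^sub>R ((1 - t)\<^sup>2 * 1) \<partial>lborel)"
    using integral_kern[of "\<lambda>_. 1"] by (simp del: lebesgue_integral_const)
  also have "\<dots> = (\<lambda>t. - ((1 - t) ^ 3 / 3)) 1 - (\<lambda>t. - ((1 - t) ^ 3 / 3)) (0::real)"
  proof (rule integral_FTC_Icc)
    fix t :: real
    show "((\<lambda>t. - ((1 - t) ^ 3 / 3)) has_vector_derivative (1 - t)\<^sup>2 * 1) (at t within {0..1})"
      unfolding has_real_derivative_iff_has_vector_derivative[symmetric]
      by (auto intro!: derivative_eq_intros simp: power2_eq_square)
  qed (auto intro!: continuous_intros)
  finally show ?thesis by simp
qed

lemma kern_cos_le: "(\<integral>t. cos (t * y) \<partial>kern) \<le> 1 / 3"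
  unfolding kern_mass[symmetric]
  by (rule integral_mono) (auto intro!: integrable_kern_bounded[of _ 1])

text \<open>For \<open>y > 0\<close> the closed form is nonnegative because
  \<open>sin y <= y\<close>, and the transform is even. In \<open>esseen_kern\<close> this allows
  points outside the interval to be ignored.\<close>

lemma kern_cos_nonneg: "0 \<le> (\<integral>t. cos (t * y) \<partial>kern)"
proof (cases "y = 0")
  case False
  then have "0 \<le> 2 * (\<bar>y\<bar> - sin \<bar>y\<bar>) / \<bar>y\<bar> ^ 3"
    using sin_x_le_x[of "\<bar>y\<bar>"] by auto
  then show ?thesis
    using kern_cos[of "\<bar>y\<bar>"] False kern_cos_abs[of y] by simp
qed (simp add: kern_mass del: lebesgue_integral_const)

text \<open>The fifth-order Taylor bound gives \<open>x - sin x >= x^3/6 - x^5/120\<close>. For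
  \<open>x <= 2\<close> we have \<open>x^5 <= 4 * x^3\<close>, which leaves
  \<open>x^3 * (1/6 - 1/30) = 2/15 * x^3\<close>.\<close>

lemma kern_cos_ge_small:
  assumes "\<bar>y\<bar> \<le> 2"
  shows "4 / 15 \<le> (\<integral>t. cos (t * y) \<partial>kern)"
proof (cases "y = 0")
  case False
  define x where "x = \<bar>y\<bar>"
  have x: "0 < x" "x \<le> 2" using assms False by (auto simp: x_def)
  have "\<bar>sin x - (\<Sum>m<5. sin_coeff m * x ^ m)\<bar> \<le> inverse (fact 5) * \<bar>x\<bar> ^ 5"
    by (rule Maclaurin_sin_bound)
  moreover have "(\<Sum>m<5. sin_coeff m * x ^ m) = x - x ^ 3 / 6"
    by (simp add: eval_nat_numeral sin_coeff_Suc cos_coeff_Suc)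
  moreover have "inverse (fact 5) * \<bar>x\<bar> ^ 5 = x ^ 5 / 120"
    using x by (simp add: fact_numeral)
  ultimately have "x - sin x \<ge> x ^ 3 / 6 - x ^ 5 / 120"
    unfolding abs_le_iff by linarith
  moreover have "x ^ 5 \<le> 4 * x ^ 3"
  proof -
    have "x ^ 3 * x\<^sup>2 \<le> x ^ 3 * 2\<^sup>2"
      using x by (intro mult_left_mono power_mono) auto
    then show ?thesis by (simp add: eval_nat_numeral mult_ac)
  qed
  ultimately have "2 * (x - sin x) / x ^ 3 \<ge> 4 / 15"
    using x by (simp add: field_simps)
  then show ?thesis
    using kern_cos[of x] x kern_cos_abs[of y] by (simp add: x_def)
qed (simp add: kern_mass del: lebesgue_integral_const)

text \<open>For \<open>\<bar>y\<bar> <= 2\<close> the right side is at least \<open>16/15\<close>,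
  above the total mass \<open>1/3\<close>. For larger \<open>x = \<bar>y\<bar>\<close> the transform
  lies between \<open>1 / x^2\<close> and \<open>4 / x^2\<close>, and dilation by \<open>z\<close>
  only shrinks the upper estimate, so the ratio is at most \<open>4\<close>.\<close>

lemma kern_cos_scale:
  assumes "\<bar>z\<bar> \<ge> 1"
  shows "(\<integral>t. cos (t * (z * y)) \<partial>kern) \<le> 4 * (\<integral>t. cos (t * y) \<partial>kern)"
proof (cases "\<bar>y\<bar> \<le> 2")
  case True
  then show ?thesis
    using kern_cos_ge_small[of y] kern_cos_le[of "z * y"] by simp
next
  case False
  define x where "x = \<bar>y\<bar>"
  define w where "w = \<bar>z * y\<bar>"
  have x: "x > 2" using False by (simp add: x_def)
  have w: "w \<ge> x" using assms by (simp add: w_def x_def abs_mult mult_le_cancel_right1)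
  have "2 * (w - sin w) / w ^ 3 \<le> 4 / w\<^sup>2"
  proof -
    have "- sin w \<le> w" using x w sin_ge_minus_one[of w] by linarith
    then have "2 * (w - sin w) / w ^ 3 \<le> 4 * w / w ^ 3"
      using x w by (intro divide_right_mono) auto
    also have "\<dots> = 4 / w\<^sup>2" using x w by (simp add: power2_eq_square power3_eq_cube)
    finally show ?thesis .
  qed
  also have "4 / w\<^sup>2 \<le> 4 / x\<^sup>2"
    using x w by (intro divide_left_mono power_mono mult_pos_pos) auto
  also have "1 / x\<^sup>2 \<le> 2 * (x - sin x) / x ^ 3"
  proof -
    have "sin x \<le> x / 2" using x by (intro order_trans[OF sin_le_one]) simp
    then have "x \<le> 2 * (x - sin x)" by simp
    then have "x / x ^ 3 \<le> 2 * (x - sin x) / x ^ 3"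
      using x by (intro divide_right_mono) auto
    then show ?thesis using x by (simp add: power2_eq_square power3_eq_cube)
  qed
  then have "4 * (1 / x\<^sup>2) \<le> 4 * (2 * (x - sin x) / x ^ 3)" by (intro mult_left_mono) auto
  then have "4 / x\<^sup>2 \<le> 4 * (2 * (x - sin x) / x ^ 3)" by (simp only: times_divide_eq_right mult_1_right)
  also have "2 * (x - sin x) / x ^ 3 = (\<integral>t. cos (t * y) \<partial>kern)"
    using kern_cos[of x] x kern_cos_abs[of y] by (simp add: x_def[symmetric])
  also have "2 * (w - sin w) / w ^ 3 = (\<integral>t. cos (t * (z * y)) \<partial>kern)"
    using kern_cos[of w] x w kern_cos_abs[of "z * y"] by (simp add: w_def[symmetric])
  finally show ?thesis .
qed

section \<open>Functions with nonnegative cosine coefficients\<close>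

text \<open>Frequencies may be arbitrary reals, as the products \<open>a k * D\<close> demand. The
  inductive form turns every claim about such sums into an induction that adds one cosine at a
  time.\<close>

inductive cos_sum :: "(real \<Rightarrow> real) \<Rightarrow> bool" where
  zero: "cos_sum (\<lambda>_. 0)"
| step: "cos_sum f \<Longrightarrow> r \<ge> 0 \<Longrightarrow> cos_sum (\<lambda>s. r * cos (b * s) + f s)"

lemma cos_sum_add:
  assumes "cos_sum f" "cos_sum g"
  shows "cos_sum (\<lambda>s. f s + g s)"
  using assms(1)
proof induction
  case zero
  then show ?case using assms(2) by simp
next
  case (step f r b)
  then show ?case using cos_sum.step[OF step(3), of r b] by (simp add: add_ac)
qed

lemma cos_sum_cos: "r \<ge> 0 \<Longrightarrow> cos_sum (\<lambda>s. r * cos (b * s))"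
  using cos_sum.step[OF cos_sum.zero, of r b] by simp

text \<open>The product-to-sum formula replaces a product of cosines by half the sum of the cosines
  of \<open>b + d\<close> and \<open>b - d\<close>, so no negative coefficient arises.\<close>

lemma cos_sum_mult_cos:
  assumes "cos_sum f" "r \<ge> 0"
  shows "cos_sum (\<lambda>s. r * cos (b * s) * f s)"
  using assms(1)
proof induction
  case zero
  then show ?case by (simp add: cos_sum.zero)
next
  case (step f q d)
  have "cos_sum (\<lambda>s. r * q / 2 * cos ((b + d) * s) + (r * q / 2 * cos ((b - d) * s) + r * cos (b * s) * f s))"
    using step assms(2) by (intro cos_sum.step) auto
  moreover have "r * q / 2 * cos ((b + d) * s) + (r * q / 2 * cos ((b - d) * s) + r * cos (b * s) * f s)
      = r * cos (b * s) * (q * cos (d * s) + f s)" for s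
    by (simp add: cos_add cos_diff algebra_simps)
  ultimately show ?case by simp
qed

lemma cos_sum_mult:
  assumes "cos_sum f" "cos_sum g"
  shows "cos_sum (\<lambda>s. f s * g s)"
  using assms(1)
proof induction
  case zero
  then show ?case by (simp add: cos_sum.zero)
next
  case (step f r b)
  have "cos_sum (\<lambda>s. r * cos (b * s) * g s + f s * g s)"
    by (intro cos_sum_add cos_sum_mult_cos step assms)
  then show ?case by (simp add: algebra_simps)
qed

lemma cos_sum_const: "r \<ge> 0 \<Longrightarrow> cos_sum (\<lambda>_. r)"
  using cos_sum_cos[of r 0] by simp

lemma cos_sum_power: "cos_sum f \<Longrightarrow> cos_sum (\<lambda>s. f s ^ j)"
  by (induction j) (auto intro: cos_sum_const cos_sum_mult)

lemma cos_sum_sum: "(\<And>i. i \<in> I \<Longrightarrow> cos_sum (f i)) \<Longrightarrow> cos_sum (\<lambda>s. \<Sum>i\<in>I. f i s)"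
  by (induction I rule: infinite_finite_induct) (auto intro: cos_sum.zero cos_sum_add)

lemma cos_sum_integrable:
  assumes "cos_sum f"
  shows "integrable kern (\<lambda>t. f (t * z))"
  using assms
proof induction
  case (step f r b)
  have "integrable kern (\<lambda>t. r * cos (b * (t * z)))"
    by (rule integrable_kern_bounded[of _ "\<bar>r\<bar>"]) (auto simp: abs_mult intro: mult_left_le)
  then show ?case using step by simp
qed simp

text \<open>\<open>kern_cos_scale\<close> applies to each cosine separately, and nonnegative
  coefficients preserve the inequality under summation.\<close>

lemma cos_sum_scale:
  assumes "cos_sum f" "\<bar>z\<bar> \<ge> 1"
  shows "(\<integral>t. f (t * z) \<partial>kern) \<le> 4 * (\<integral>t. f t \<partial>kern)"
  using assms(1)
proof induction
  case (step f r b)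
  have eq: "(\<integral>t. r * cos (b * (t * w)) + f (t * w) \<partial>kern)
    = r * (\<integral>t. cos (t * (w * b)) \<partial>kern) + (\<integral>t. f (t * w) \<partial>kern)" for w
  proof -
    have "(\<integral>t. r * cos (b * (t * w)) + f (t * w) \<partial>kern)
      = (\<integral>t. r * cos (b * (t * w)) \<partial>kern) + (\<integral>t. f (t * w) \<partial>kern)"
      using cos_sum_integrable[OF cos_sum_cos[of r b], of w] cos_sum_integrable[OF step(1), of w] step(2)
      by (intro Bochner_Integration.integral_add) auto
    then show ?thesis by (simp add: mult_ac)
  qed
  show ?case
    using eq[of z] eq[of 1] mult_left_mono[OF kern_cos_scale[OF assms(2), of b] step(2)] step(3)
    by (simp add: algebra_simps)
qed simp

text \<open>\<open>exp (f s)\<close> need not be a finite cosine sum, but the partial sums of its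
  power series are, by closure under products. The inequality passes to the limit by dominated
  convergence with the constant \<open>exp B\<close>.\<close>

lemma cos_sum_exp_scale:
  assumes "cos_sum f" "\<bar>z\<bar> \<ge> 1" "\<And>s. \<bar>f s\<bar> \<le> B"
  shows "(\<integral>t. exp (f (t * z)) \<partial>kern) \<le> 4 * (\<integral>t. exp (f t) \<partial>kern)"
proof -
  define T where "T N s = (\<Sum>j<N. 1 / fact j * f s ^ j)" for N s
  have T: "cos_sum (T N)" for N
    unfolding T_def by (intro cos_sum_sum cos_sum_mult cos_sum_power cos_sum_const assms) auto
  have lim: "(\<lambda>N. T N s) \<longlonglongrightarrow> exp (f s)" for s
    using exp_converges[of "f s"] by (simp add: T_def sums_def field_simps)
  have bound: "\<bar>T N s\<bar> \<le> exp B" for N s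
  proof -
    have "\<bar>T N s\<bar> \<le> (\<Sum>j<N. \<bar>1 / fact j * f s ^ j\<bar>)"
      unfolding T_def by (rule sum_abs)
    also have "\<dots> \<le> (\<Sum>j<N. B ^ j /\<^sub>R fact j)"
      by (intro sum_mono) (auto simp: abs_mult power_abs divide_simps intro!: power_mono assms)
    also have "\<dots> \<le> (\<Sum>j. B ^ j /\<^sub>R fact j)"
      \<comment> \<open>The bound at \<open>0\<close> forces \<open>B >= 0\<close>, so the omitted
        tail of the series is nonnegative.\<close>
      using assms(3)[of 0] by (intro sum_le_suminf summable_exp_generic) auto
    finally show ?thesis by (simp add: exp_def)
  qed
  have conv: "(\<lambda>N. \<integral>t. T N (t * w) \<partial>kern) \<longlonglongrightarrow> (\<integral>t. exp (f (t * w)) \<partial>kern)" for w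
  proof (rule integral_dominated_convergence[where w = "\<lambda>_. exp B"])
    show "(\<lambda>t. exp (f (t * w))) \<in> borel_measurable kern"
      using borel_measurable_integrable[OF cos_sum_integrable[OF assms(1)]] by measurable
    show "(\<lambda>t. T N (t * w)) \<in> borel_measurable kern" for N
      using borel_measurable_integrable[OF cos_sum_integrable[OF T]] .
  qed (use lim bound in auto)
  have "(\<lambda>N. 4 * (\<integral>t. T N t \<partial>kern)) \<longlonglongrightarrow> 4 * (\<integral>t. exp (f t) \<partial>kern)"
    using tendsto_mult[OF tendsto_const conv[of 1]] by simp
  then show ?thesis
    by (rule LIMSEQ_le[OF conv[of z]]) (use cos_sum_scale[OF T assms(2)] in auto)
qed

section \<open>Cosine defects and distance to the integer lattice\<close>

text \<open>Write the left side as \<open>2 * (sin y)^2\<close> with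
  \<open>y = pi * \<bar>r\<bar> <= pi / 2\<close>. There \<open>y^2 <= 5/2\<close>, so the cubic
  Taylor bound yields \<open>sin y >= 7/12 * y >= 7/4 * \<bar>r\<bar>\<close>, and
  \<open>49/16 >= 3\<close>.\<close>

lemma one_minus_cos_ge:
  assumes "\<bar>r\<bar> \<le> 1 / 2"
  shows "1 - cos (2 * pi * r) \<ge> 6 * r\<^sup>2"
proof -
  define y where "y = pi * \<bar>r\<bar>"
  have y: "0 \<le> y" "y \<le> pi / 2" using assms by (auto simp: y_def)
  have "\<bar>sin y - (\<Sum>m<3. sin_coeff m * y ^ m)\<bar> \<le> inverse (fact 3) * \<bar>y\<bar> ^ 3"
    by (rule Maclaurin_sin_bound)
  moreover have "(\<Sum>m<3. sin_coeff m * y ^ m) = y"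
    by (simp add: eval_nat_numeral sin_coeff_Suc cos_coeff_Suc)
  moreover have "inverse (fact 3) * \<bar>y\<bar> ^ 3 = y ^ 3 / 6"
    using y by (simp add: fact_numeral)
  ultimately have "sin y \<ge> y - y ^ 3 / 6"
    unfolding abs_le_iff by linarith
  moreover have "y ^ 3 \<le> 5 / 2 * y"
  proof -
    have "y \<le> 1.58" using y pi_approx by simp
    then have "y\<^sup>2 \<le> 1.58\<^sup>2" using y by (intro power_mono) auto
    also have "\<dots> \<le> (5 / 2 :: real)" by (simp add: power2_eq_square)
    finally have "y * y\<^sup>2 \<le> y * (5 / 2)" using y by (intro mult_left_mono) auto
    then show ?thesis by (simp add: power3_eq_cube power2_eq_square)
  qed
  ultimately have s: "sin y \<ge> 7 / 12 * y" by simp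
  have "y \<ge> 3 * \<bar>r\<bar>" unfolding y_def using pi_approx by (intro mult_right_mono) auto
  then have "sin y \<ge> 7 / 4 * \<bar>r\<bar>" using s by simp
  then have "(7 / 4 * \<bar>r\<bar>)\<^sup>2 \<le> (sin y)\<^sup>2" by (intro power_mono) auto
  then have "3 * r\<^sup>2 \<le> (sin y)\<^sup>2" by (simp add: power_mult_distrib power2_eq_square) (use zero_le_square[of r] in linarith)
  moreover have "cos (2 * pi * r) = cos (2 * y)"
    by (cases "r \<ge> 0") (auto simp: y_def mult_ac)
  moreover have "cos (2 * y) = 1 - 2 * (sin y)\<^sup>2" by (simp add: cos_double_sin)
  ultimately show ?thesis by simp
qed

text \<open>The function \<open>g\<close> of the outline. It vanishes exactly when the first
  \<open>n\<close> coordinates of \<open>s * a / (2 * pi)\<close> are integers.\<close>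

definition defect :: "nat \<Rightarrow> (nat \<Rightarrow> real) \<Rightarrow> real \<Rightarrow> real" where
  "defect n a s = (\<Sum>k<n. 1 - cos (a k * s))"

lemma defect_nonneg: "0 \<le> defect n a s"
  unfolding defect_def by (intro sum_nonneg) auto

lemma defect_le: "defect n a s \<le> 2 * real n"
proof -
  have "defect n a s \<le> (\<Sum>k<n. 2)"
    unfolding defect_def
  proof (rule sum_mono)
    fix k show "1 - cos (a k * s) \<le> 2" using cos_ge_minus_one[of "a k * s"] by linarith
  qed
  then show ?thesis by simp
qed

lemma defect_abs: "defect n a \<bar>s\<bar> = defect n a s"
  unfolding defect_def by (rule sum.cong) (auto simp: abs_if)

lemma defect_measurable [measurable]: "defect n a \<in> borel_measurable borel"
  unfolding defect_def[abs_def] by measurable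

text \<open>Integer shifts do not change \<open>cos (2 * pi * r)\<close>, so
  \<open>one_minus_cos_ge\<close> applies to each coordinate's offset from
  \<open>m k\<close>.\<close>

lemma defect_ge_lattice:
  assumes "\<And>k. k < n \<Longrightarrow> \<bar>u * a k - of_int (m k)\<bar> \<le> 1 / 2"
  shows "6 * (eucl_norm n (\<lambda>k. u * a k - of_int (m k)))\<^sup>2 \<le> defect n a (2 * pi * u)"
proof -
  have "6 * (eucl_norm n (\<lambda>k. u * a k - of_int (m k)))\<^sup>2 = (\<Sum>k<n. 6 * (u * a k - of_int (m k))\<^sup>2)"
    by (simp add: eucl_norm_def sum_nonneg sum_distrib_left)
  also have "\<dots> \<le> defect n a (2 * pi * u)"
    unfolding defect_def
  proof (rule sum_mono)
    fix k assume "k \<in> {..<n}"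
    then have "6 * (u * a k - of_int (m k))\<^sup>2 \<le> 1 - cos (2 * pi * (u * a k - of_int (m k)))"
      using assms by (intro one_minus_cos_ge) auto
    also have "cos (2 * pi * (u * a k - of_int (m k))) = cos (a k * (2 * pi * u) - 2 * pi * of_int (m k))"
      by (simp add: algebra_simps)
    also have "\<dots> = cos (a k * (2 * pi * u))"
      by (simp add: cos_diff)
    finally show "6 * (u * a k - of_int (m k))\<^sup>2 \<le> 1 - cos (a k * (2 * pi * u))" .
  qed
  finally show ?thesis .
qed

text \<open>
  Below \<open>1 / (2 supnorm n a)\<close>, where the hypothesis says nothing, the nearest lattice point to
  \<open>u a\<close> is the origin, at distance \<open>u\<close>.
\<close>

lemma defect_lower_bound:
  assumes norm: "eucl_norm n a = 1" and u: "0 < u" "u \<le> D" and "L > 0"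
    and dist: "\<And>(m::nat \<Rightarrow> int) t. 1 / (2 * supnorm n a) \<le> t \<Longrightarrow> t \<le> D \<Longrightarrow>
        eucl_norm n (\<lambda>k. t * a k - of_int (m k)) \<ge> fL L t"
  shows "defect n a (2 * pi * u) \<ge> u\<^sup>2 / 6 \<or>
    exp 1 * L \<le> u \<and> defect n a (2 * pi * u) \<ge> 6 * L\<^sup>2 * ln (u / L)"
proof (cases "1 / (2 * supnorm n a) \<le> u")
  case True
  define m where "m k = round (u * a k)" for k
  have *: "6 * (eucl_norm n (\<lambda>k. u * a k - of_int (m k)))\<^sup>2 \<le> defect n a (2 * pi * u)"
    unfolding m_def
    by (rule defect_ge_lattice, subst abs_minus_commute, rule of_int_round_abs_le)
  have fL: "fL L u \<le> eucl_norm n (\<lambda>k. u * a k - of_int (m k))"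
    using dist True u by blast
  show ?thesis
  proof (cases "u < exp 1 * L")
    case True
    then have "(u / 6)\<^sup>2 \<le> (eucl_norm n (\<lambda>k. u * a k - of_int (m k)))\<^sup>2"
      using fL u by (intro power_mono) (auto simp: fL_def)
    then show ?thesis using * by (simp add: power2_eq_square)
  next
    case False
    then have "exp 1 \<le> u / L"
      using \<open>L > 0\<close> by (simp add: pos_le_divide_eq)
    moreover have "(1::real) \<le> exp 1" by simp
    ultimately have "ln (u / L) \<ge> 0" by (intro ln_ge_zero) linarith
    moreover have "(L * sqrt (ln (u / L)))\<^sup>2 \<le> (eucl_norm n (\<lambda>k. u * a k - of_int (m k)))\<^sup>2"
      using fL False \<open>L > 0\<close> \<open>ln (u / L) \<ge> 0\<close> by (intro power_mono) (auto simp: fL_def)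
    ultimately show ?thesis using * False by (simp add: power_mult_distrib)
  qed
next
  case False
  have ak: "\<bar>a k\<bar> \<le> supnorm n a" if "k < n" for k
    unfolding supnorm_def using that by (intro Max_ge) auto
  have "6 * (eucl_norm n (\<lambda>k. u * a k - of_int (0::int)))\<^sup>2 \<le> defect n a (2 * pi * u)"
  proof (rule defect_ge_lattice)
    fix k assume k: "k < n"
    show "\<bar>u * a k - of_int 0\<bar> \<le> 1 / 2"
    \<comment> \<open>Clearing the denominator in the failed inequality needs a positive supremum
      norm; without it the coordinate itself is zero.\<close>
    proof (cases "supnorm n a > 0")
      case True
      have "\<bar>u * a k\<bar> \<le> u * supnorm n a"
        using ak[OF k] u by (simp add: abs_mult)
      also have "\<dots> \<le> 1 / 2" using False True by (simp add: field_simps)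
      finally show ?thesis by simp
    next
      case False
      then have "a k = 0" using ak[OF k] by linarith
      then show ?thesis by simp
    qed
  qed
  also have "(eucl_norm n (\<lambda>k. u * a k - of_int (0::int)))\<^sup>2 = u\<^sup>2"
    using norm by (simp add: eucl_norm_def power_mult_distrib sum_distrib_left[symmetric] sum_nonneg)
  finally have "6 * u\<^sup>2 \<le> defect n a (2 * pi * u)" .
  moreover have "0 \<le> u\<^sup>2" by simp
  ultimately have "u\<^sup>2 / 6 \<le> defect n a (2 * pi * u)" by linarith
  then show ?thesis ..
qed

section \<open>Averages of the exponential, uniformly in the symmetrised value\<close>

text \<open>Both alternatives of \<open>defect_lower_bound\<close> lead to a Lorentzian in
  \<open>s\<close> free of \<open>z\<close>. In the logarithmic one the exponential is at most a
  power \<open>v\<close> to the \<open>-b\<close>, and \<open>L^2 >= 1 / M\<close> gives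
  \<open>b >= 3\<close>, faster than the inverse square required.\<close>

lemma exp_defect_le:
  assumes norm: "eucl_norm n a = 1" and "L > 0" and M: "M > 0" "L\<^sup>2 \<ge> 1 / M"
    and dist: "\<And>(m::nat \<Rightarrow> int) t. 1 / (2 * supnorm n a) \<le> t \<Longrightarrow> t \<le> D \<Longrightarrow>
        eucl_norm n (\<lambda>k. t * a k - of_int (m k)) \<ge> fL L t"
    and s: "0 \<le> s" "s \<le> D" and z: "0 < \<bar>z\<bar>" "\<bar>z\<bar> \<le> 1"
  shows "exp (- (M / 2 * (defect n a (s * z) / z\<^sup>2))) \<le> 48 / (1 + M * s\<^sup>2 / pi\<^sup>2)"
proof (cases "s = 0")
  case True
  then show ?thesis by (simp add: defect_def)
next
  case False
  define u where "u = s * \<bar>z\<bar> / (2 * pi)"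
  define x where "x = M * s\<^sup>2 / pi\<^sup>2"
  have x0: "x \<ge> 0" using M by (simp add: x_def)
  have u: "0 < u" using False s z by (simp add: u_def)
  have "u \<le> D"
  proof -
    have "s * \<bar>z\<bar> \<le> D * (2 * pi)"
      using s z pi_approx by (intro mult_mono) auto
    then show ?thesis by (simp add: u_def pos_divide_le_eq)
  qed
  have us: "2 * pi * u = s * \<bar>z\<bar>" by (simp add: u_def)
  have du: "defect n a (2 * pi * u) = defect n a (s * z)"
    unfolding us using defect_abs[of n a "s * z"] s by (simp add: abs_mult)
  \<comment> \<open>Division by \<open>z^2\<close> cancels the \<open>z\<close> hidden in
    \<open>u\<close>; this is the source of uniformity in \<open>z\<close>.\<close>
  have u2: "M * u\<^sup>2 / z\<^sup>2 = x / 4"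
    using z by (simp add: u_def x_def power_divide power_mult_distrib)
  define A where "A = M / 2 * (defect n a (s * z) / z\<^sup>2)"
  from defect_lower_bound[OF norm u \<open>u \<le> D\<close> \<open>L > 0\<close> dist]
  have "exp (- A) \<le> 48 / (1 + x)"
    unfolding du
  proof (rule disjE)
    assume "u\<^sup>2 / 6 \<le> defect n a (s * z)"
    then have "M / 2 * (u\<^sup>2 / 6 / z\<^sup>2) \<le> A"
      unfolding A_def using M by (intro mult_left_mono divide_right_mono) auto
    moreover have "M / 2 * (u\<^sup>2 / 6 / z\<^sup>2) = M * u\<^sup>2 / z\<^sup>2 / 12" by simp
    ultimately have "x / 48 \<le> A" unfolding u2 by linarith
    then have "1 + x / 48 \<le> exp A" using exp_ge_add_one_self[of A] by linarith
    then have "exp (- A) \<le> 1 / (1 + x / 48)"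
      using x0 by (simp add: exp_minus field_simps)
    also have "\<dots> \<le> 48 / (1 + x)" using x0 by (simp add: field_simps)
    finally show ?thesis .
  next
    assume "exp 1 * L \<le> u \<and> 6 * L\<^sup>2 * ln (u / L) \<le> defect n a (s * z)"
    then have v: "exp 1 * L \<le> u" and g: "6 * L\<^sup>2 * ln (u / L) \<le> defect n a (s * z)" by auto
    define b where "b = 3 * M * L\<^sup>2 / z\<^sup>2"
    define v where "v = u / L"
    have v1: "exp 1 \<le> v" using v \<open>L > 0\<close> by (simp add: v_def field_simps)
    have v0: "v > 0" using v1 exp_gt_zero[of "1::real"] by linarith
    have lnv: "ln v \<ge> 1" using v1 v0 by (simp add: ln_ge_iff)
    have "z\<^sup>2 \<le> 1" using z by (simp add: abs_square_le_1)
    moreover have "1 \<le> M * L\<^sup>2" using M by (simp add: field_simps)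
    ultimately have b: "b \<ge> 3" using z by (simp add: b_def field_simps)
    have "M / 2 * (6 * L\<^sup>2 * ln (u / L) / z\<^sup>2) \<le> A"
      unfolding A_def using M g by (intro mult_left_mono divide_right_mono) auto
    moreover have "M / 2 * (6 * L\<^sup>2 * ln (u / L) / z\<^sup>2) = b * ln v" by (simp add: b_def v_def)
    ultimately have "b * ln v \<le> A" by simp
    have bv: "b * v\<^sup>2 = 3 / 4 * x"
      using u2 \<open>L > 0\<close> by (simp add: b_def v_def power_divide)
    have "exp 1 > (1::real)" by simp
    then have "v \<ge> 1" using v1 by linarith
    then have "v\<^sup>2 \<ge> 1" by simp
    then have "3 * 1 \<le> b * v\<^sup>2" using b by (intro mult_mono) auto
    \<comment> \<open>Since \<open>b * v^2 >= 3\<close>, the summand \<open>1\<close> is at most a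
      third of \<open>b * v^2\<close>, while \<open>x\<close> is four thirds of it.\<close>
    then have x1: "1 + x \<le> 2 * (b * v\<^sup>2)" using bv by linarith
    have "(1 + x) * exp (- A) \<le> 2 * (b * v\<^sup>2) * exp (- (b * ln v))"
      using x1 \<open>b * ln v \<le> A\<close> b by (intro mult_mono) auto
    also have "v\<^sup>2 = exp (2 * ln v)" using v0 by (simp add: exp_double)
    also have "2 * (b * exp (2 * ln v)) * exp (- (b * ln v)) = 2 * b * exp (- ((b - 2) * ln v))"
      by (simp add: mult_exp_exp algebra_simps)
    \<comment> \<open>As \<open>b > 2\<close> and \<open>ln v >= 1\<close>, the worst case is
      \<open>ln v = 1\<close>. The linear factor \<open>b\<close> is then absorbed by
      \<open>b <= exp (b - 1)\<close>.\<close>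
    also have "\<dots> \<le> 2 * b * exp (2 - b)"
    proof -
      have "(b - 2) * 1 \<le> (b - 2) * ln v" using b lnv by (intro mult_left_mono) auto
      then have "- ((b - 2) * ln v) \<le> - (b - 2)" by (simp only: neg_le_iff_le mult_1_right)
      then have "- ((b - 2) * ln v) \<le> 2 - b" by (simp only: minus_diff_eq)
      then show ?thesis using b by (intro mult_left_mono iffD2[OF exp_le_cancel_iff]) auto
    qed
    also have "\<dots> \<le> 2 * exp (b - 1) * exp (2 - b)"
      using exp_ge_add_one_self[of "b - 1"] by (intro mult_right_mono) auto
    also have "\<dots> = 2 * exp 1" by (simp add: mult_exp_exp)
    also have "\<dots> \<le> 48" using exp_le by simp
    finally show ?thesis using x0 by (simp add: field_simps)
  qed
  then show ?thesis by (simp add: A_def x_def)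
qed

text \<open>Bound the weight \<open>(1 - t)^2\<close> by \<open>1\<close>, integrate to an
  arctangent, and use that it stays below \<open>pi / 2\<close>.\<close>

lemma kern_lorentzian_le:
  assumes "b > 0"
  shows "(\<integral>t. 1 / (1 + (b * t)\<^sup>2) \<partial>kern) \<le> pi / (2 * b)"
proof -
  have pos: "1 + (b * t)\<^sup>2 > 0" for t
    by (simp add: add_pos_nonneg)
  have "(\<integral>t. 1 / (1 + (b * t)\<^sup>2) \<partial>kern)
      = (\<integral>t. indicator {0..1} t *\<^sub>R ((1 - t)\<^sup>2 * (1 / (1 + (b * t)\<^sup>2))) \<partial>lborel)"
    by (rule integral_kern) simp
  also have "\<dots> \<le> (\<integral>t. indicator {0..1} t *\<^sub>R (1 / (1 + (b * t)\<^sup>2)) \<partial>lborel)"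
  proof (rule integral_mono)
    show "integrable lborel (\<lambda>t. indicator {0..1} t *\<^sub>R ((1 - t)\<^sup>2 * (1 / (1 + (b * t)\<^sup>2))))"
      using pos by (intro borel_integrable_compact continuous_intros) (auto simp: less_imp_neq[symmetric])
    show "integrable lborel (\<lambda>t. indicator {0..1} t *\<^sub>R (1 / (1 + (b * t)\<^sup>2)))"
      using pos by (intro borel_integrable_compact continuous_intros) (auto simp: less_imp_neq[symmetric])
    fix t :: real
    show "indicator {0..1} t *\<^sub>R ((1 - t)\<^sup>2 * (1 / (1 + (b * t)\<^sup>2))) \<le> indicator {0..1} t *\<^sub>R (1 / (1 + (b * t)\<^sup>2))"
      using pos[of t] by (auto simp: indicator_def power_le_one divide_le_cancel)
  qed
  also have "\<dots> = arctan (b * 1) / b - arctan (b * 0) / b"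
  proof (rule integral_FTC_Icc)
    fix t :: real
    have "((\<lambda>t. arctan (b * t) / b) has_real_derivative inverse (1 + (b * t)\<^sup>2) * b / b) (at t within {0..1})"
      by (auto intro!: derivative_eq_intros)
    then show "((\<lambda>t. arctan (b * t) / b) has_vector_derivative 1 / (1 + (b * t)\<^sup>2)) (at t within {0..1})"
      unfolding has_real_derivative_iff_has_vector_derivative[symmetric]
      using assms by (simp add: inverse_eq_divide)
    show "continuous_on {0..1} (\<lambda>t. 1 / (1 + (b * t)\<^sup>2))"
      using pos by (intro continuous_intros) (auto simp: less_imp_neq[symmetric])
  qed simp
  also have "\<dots> \<le> (pi / 2) / b"
    using assms arctan_ubound[of b] by (simp add: field_simps)
  finally show ?thesis by simp
qed

lemma kern_exp_defect_le_near:
  assumes norm: "eucl_norm n a = 1" and "L > 0" "D > 0" and M: "M > 0" "L\<^sup>2 \<ge> 1 / M"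
    and dist: "\<And>(m::nat \<Rightarrow> int) t. 1 / (2 * supnorm n a) \<le> t \<Longrightarrow> t \<le> D \<Longrightarrow>
        eucl_norm n (\<lambda>k. t * a k - of_int (m k)) \<ge> fL L t"
    and z: "0 < \<bar>z\<bar>" "\<bar>z\<bar> \<le> 1"
  shows "(\<integral>t. exp (- (M / 2 * (defect n a (t * D * z) / z\<^sup>2))) \<partial>kern) \<le> 24 * pi\<^sup>2 / (D * sqrt M)"
proof -
  \<comment> \<open>With this \<open>b\<close>, \<open>(b * t)^2\<close> is the term
    \<open>M * s^2 / pi^2\<close> of \<open>exp_defect_le\<close> at
    \<open>s = t * D\<close>.\<close>
  define b where "b = sqrt M * D / pi"
  have b: "b > 0" using M \<open>D > 0\<close> by (simp add: b_def)
  have "(\<integral>t. exp (- (M / 2 * (defect n a (t * D * z) / z\<^sup>2))) \<partial>kern)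
      \<le> (\<integral>t. 48 * (1 / (1 + (b * t)\<^sup>2)) \<partial>kern)"
  proof (rule integral_mono_AE)
    show "integrable kern (\<lambda>t. exp (- (M / 2 * (defect n a (t * D * z) / z\<^sup>2))))"
      using M by (intro integrable_kern_bounded[of _ 1]) (auto simp: defect_nonneg)
    show "integrable kern (\<lambda>t. 48 * (1 / (1 + (b * t)\<^sup>2)))"
    proof (intro integrable_kern_bounded[of _ 48])
      fix t show "\<bar>48 * (1 / (1 + (b * t)\<^sup>2))\<bar> \<le> 48"
        by (simp add: abs_mult field_simps add_pos_nonneg)
    qed simp
    show "AE t in kern. exp (- (M / 2 * (defect n a (t * D * z) / z\<^sup>2))) \<le> 48 * (1 / (1 + (b * t)\<^sup>2))"
      using AE_kern
    proof eventually_elim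
      fix t :: real assume t: "0 \<le> t \<and> t \<le> 1"
      have "M * (t * D)\<^sup>2 / pi\<^sup>2 = (b * t)\<^sup>2"
        using M by (simp add: b_def power_mult_distrib power_divide)
      moreover have "exp (- (M / 2 * (defect n a (t * D * z) / z\<^sup>2))) \<le> 48 / (1 + M * (t * D)\<^sup>2 / pi\<^sup>2)"
        using t \<open>D > 0\<close> by (intro exp_defect_le[OF norm \<open>L > 0\<close> M dist _ _ z]) auto
      ultimately show "exp (- (M / 2 * (defect n a (t * D * z) / z\<^sup>2))) \<le> 48 * (1 / (1 + (b * t)\<^sup>2))"
        by simp
    qed
  qed
  also have "\<dots> = 48 * (\<integral>t. 1 / (1 + (b * t)\<^sup>2) \<partial>kern)"
    by (rule integral_mult_right_zero)
  also have "\<dots> \<le> 48 * (pi / (2 * b))"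
    by (intro mult_left_mono kern_lorentzian_le b) auto
  also have "\<dots> = 24 * pi\<^sup>2 / (D * sqrt M)"
    using b by (simp add: b_def field_simps power2_eq_square)
  finally show ?thesis .
qed

lemma kern_exp_defect_le:
  assumes norm: "eucl_norm n a = 1" and "L > 0" "D > 0" and M: "M > 0" "L\<^sup>2 \<ge> 1 / M"
    and dist: "\<And>(m::nat \<Rightarrow> int) t. 1 / (2 * supnorm n a) \<le> t \<Longrightarrow> t \<le> D \<Longrightarrow>
        eucl_norm n (\<lambda>k. t * a k - of_int (m k)) \<ge> fL L t"
    and z: "z \<noteq> 0"
  shows "(\<integral>t. exp (- (M / 2 * (defect n a (t * D * z) / min (z\<^sup>2) 1))) \<partial>kern) \<le> 96 * pi\<^sup>2 / (D * sqrt M)"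
proof (cases "\<bar>z\<bar> \<le> 1")
  case True
  then have "min (z\<^sup>2) 1 = z\<^sup>2" by (simp add: abs_square_le_1 min_def)
  then have "(\<integral>t. exp (- (M / 2 * (defect n a (t * D * z) / min (z\<^sup>2) 1))) \<partial>kern) \<le> 24 * pi\<^sup>2 / (D * sqrt M)"
    using kern_exp_defect_le_near[OF assms(1-6), of z] z True by simp
  also have "\<dots> \<le> 96 * pi\<^sup>2 / (D * sqrt M)"
    using M \<open>D > 0\<close> by (intro divide_right_mono) auto
  finally show ?thesis .
next
  case False
  then have z1: "\<bar>z\<bar> \<ge> 1" by simp
  then have min: "min (z\<^sup>2) 1 = 1" using abs_le_square_iff[of 1 z] by simp
  \<comment> \<open>The defect is \<open>n\<close> minus a sum of cosines. Pulling out the constant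
    factor \<open>exp (- (M / 2 * n))\<close> leaves an exponent with nonnegative cosine
    coefficients, so scaling reduces \<open>z\<close> to \<open>1\<close>, where the near case
    applies.\<close>
  define f where "f s = (\<Sum>k<n. M / 2 * cos (a k * D * s))" for s
  have f: "exp (- (M / 2 * defect n a (s * D))) = exp (- (M / 2 * n)) * exp (f s)" for s
    by (simp add: f_def defect_def sum_subtractf sum_distrib_left mult_exp_exp algebra_simps)
  have f4: "exp (- (M / 2 * n)) * (4 * (\<integral>t. exp (f t) \<partial>kern)) = 4 * (\<integral>t. exp (- (M / 2 * defect n a (t * D))) \<partial>kern)"
    unfolding f by simp
  have cs: "cos_sum f"
    unfolding f_def[abs_def] using M by (intro cos_sum_sum cos_sum_cos) auto
  have bound: "\<bar>f s\<bar> \<le> M / 2 * n" for s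
  proof -
    have "\<bar>f s\<bar> \<le> (\<Sum>k<n. \<bar>M / 2 * cos (a k * D * s)\<bar>)" unfolding f_def by (rule sum_abs)
    also have "\<dots> \<le> (\<Sum>k<n. M / 2)"
      using M by (intro sum_mono) (auto simp: abs_mult)
    finally show ?thesis by (simp add: mult.commute)
  qed
  have "(\<integral>t. exp (- (M / 2 * (defect n a (t * D * z) / min (z\<^sup>2) 1))) \<partial>kern)
      = exp (- (M / 2 * n)) * (\<integral>t. exp (f (t * z)) \<partial>kern)"
    using f[of "t * z" for t] by (simp add: min mult_ac)
  also have "\<dots> \<le> exp (- (M / 2 * n)) * (4 * (\<integral>t. exp (f t) \<partial>kern))"
    by (intro mult_left_mono cos_sum_exp_scale[OF cs z1 bound]) auto
  also have "\<dots> = 4 * (\<integral>t. exp (- (M / 2 * (defect n a (t * D * 1) / 1\<^sup>2))) \<partial>kern)"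
    unfolding f4 by simp
  also have "\<dots> \<le> 4 * (24 * pi\<^sup>2 / (D * sqrt M))"
    by (intro mult_left_mono kern_exp_defect_le_near[OF assms(1-6)]) auto
  finally show ?thesis by simp
qed

section \<open>Characteristic functions and symmetrisation\<close>

lemma char_law_S:
  assumes "real_distribution P"
  shows "char (law_S n a P) t = (\<Prod>k<n. char P (t * a k))"
proof -
  interpret P: real_distribution P by fact
  interpret product_sigma_finite "\<lambda>_::nat. P" ..
  have "char (law_S n a P) t = (\<integral>x. iexp (t * (\<Sum>k<n. a k * x k)) \<partial>PiM {..<n} (\<lambda>_. P))"
    unfolding law_S_def char_def by (subst integral_distr) auto
  also have "\<dots> = (\<integral>x. (\<Prod>k<n. iexp (t * a k * x k)) \<partial>PiM {..<n} (\<lambda>_. P))"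
    by (simp add: exp_sum[symmetric] sum_distrib_left mult_ac)
  also have "\<dots> = (\<Prod>k<n. \<integral>x. iexp (t * a k * x) \<partial>P)"
    by (intro product_integral_prod P.integrable_iexp) auto
  finally show ?thesis by (simp add: char_def)
qed

lemma real_distribution_law_S:
  assumes "real_distribution P"
  shows "real_distribution (law_S n a P)"
proof -
  interpret P: real_distribution P by fact
  interpret prob_space "PiM {..<n} (\<lambda>_. P)"
    by (intro prob_space_PiM P.prob_space_axioms)
  show ?thesis unfolding law_S_def by (rule real_distribution_distr) auto
qed

lemma real_distribution_law_sym:
  assumes "real_distribution P"
  shows "real_distribution (law_sym P)"
proof -
  interpret P: real_distribution P by fact
  interpret PP: pair_prob_space P P ..
  show ?thesis unfolding law_sym_def by (rule PP.real_distribution_distr) auto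
qed

text \<open>Expanding \<open>cos (s * (x - y))\<close> by the addition formula and integrating over
  both copies gives the squared real part plus the squared imaginary part of
  \<open>char P s\<close>.\<close>

lemma cmod_char_square:
  assumes "real_distribution P"
  shows "(cmod (char P s))\<^sup>2 = (\<integral>z. cos (s * z) \<partial>law_sym P)"
proof -
  interpret P: real_distribution P by fact
  interpret PP: pair_prob_space P P ..
  have int: "integrable P (\<lambda>x. iexp (s * x))"
    by (rule P.integrable_iexp) auto
  have intc: "integrable P (\<lambda>x. cos (s * x))" and ints: "integrable P (\<lambda>x. sin (s * x))"
    by (auto intro!: P.integrable_const_bound[of _ 1])
  define c where "c = (\<integral>x. cos (s * x) \<partial>P)"
  define d where "d = (\<integral>x. sin (s * x) \<partial>P)"
  have Re: "Re (char P s) = c"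
    unfolding char_def c_def by (subst integral_Re[OF int, symmetric]) (simp add: Re_exp)
  have Im: "Im (char P s) = d"
    unfolding char_def d_def by (subst integral_Im[OF int, symmetric]) (simp add: Im_exp)
  have "(\<integral>z. cos (s * z) \<partial>law_sym P) = (\<integral>p. cos (s * (fst p - snd p)) \<partial>(P \<Otimes>\<^sub>M P))"
    unfolding law_sym_def by (subst integral_distr) (auto simp: case_prod_beta)
  also have "\<dots> = (\<integral>x. (\<integral>y. cos (s * (x - y)) \<partial>P) \<partial>P)"
    by (subst PP.integral_fst'[symmetric]) (auto intro!: PP.P.integrable_const_bound[of _ 1])
  also have "\<dots> = (\<integral>x. cos (s * x) * c + sin (s * x) * d \<partial>P)"
  proof (rule Bochner_Integration.integral_cong)
    fix x
    have "(\<integral>y. cos (s * (x - y)) \<partial>P) = (\<integral>y. cos (s * x) * cos (s * y) + sin (s * x) * sin (s * y) \<partial>P)"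
      by (simp add: cos_diff right_diff_distrib)
    also have "\<dots> = cos (s * x) * c + sin (s * x) * d"
      using intc ints unfolding c_def d_def by (subst Bochner_Integration.integral_add) auto
    finally show "(\<integral>y. cos (s * (x - y)) \<partial>P) = cos (s * x) * c + sin (s * x) * d" .
  qed simp
  also have "\<dots> = c * c + d * d"
    using intc ints unfolding c_def[symmetric] d_def[symmetric]
    by (subst Bochner_Integration.integral_add) (auto simp: c_def d_def)
  also have "\<dots> = (cmod (char P s))\<^sup>2"
    by (simp add: cmod_def Re Im power2_eq_square)
  finally show ?thesis ..
qed

text \<open>With \<open>q\<close> the squared modulus, \<open>q <= exp (q - 1)\<close> and
  \<open>1 - q\<close> is the integral on the right; taking square roots produces the factor
  \<open>1 / 2\<close>.\<close>

lemma cmod_char_le_exp: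
  assumes "real_distribution P"
  shows "cmod (char P s) \<le> exp (- ((\<integral>z. 1 - cos (s * z) \<partial>law_sym P) / 2))"
proof -
  interpret R: real_distribution "law_sym P" by (rule real_distribution_law_sym[OF assms])
  have "integrable (law_sym P) (\<lambda>z. cos (s * z))"
    by (auto intro!: R.integrable_const_bound[of _ 1])
  then have eq: "(\<integral>z. 1 - cos (s * z) \<partial>law_sym P) = 1 - (cmod (char P s))\<^sup>2"
    using R.prob_space by (simp add: cmod_char_square[OF assms])
  define q where "q = (cmod (char P s))\<^sup>2"
  have "q \<le> exp (q - 1)" using exp_ge_add_one_self[of "q - 1"] by simp
  also have "\<dots> = (exp (- ((1 - q) / 2)))\<^sup>2"
    by (simp add: exp_double[symmetric] field_simps)
  finally show ?thesis
    unfolding eq q_def by (rule power2_le_imp_le) simp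
qed

lemma cmod_char_law_S_le:
  assumes "real_distribution P"
  shows "cmod (char (law_S n a P) s) \<le> exp (- ((\<integral>z. defect n a (s * z) \<partial>law_sym P) / 2))"
proof -
  interpret R: real_distribution "law_sym P" by (rule real_distribution_law_sym[OF assms])
  have "integrable (law_sym P) (\<lambda>z. cos (s * a k * z))" for k
    by (auto intro!: R.integrable_const_bound[of _ 1])
  then have int: "integrable (law_sym P) (\<lambda>z. 1 - cos (s * a k * z))" for k
    by simp
  have "cmod (char (law_S n a P) s) = (\<Prod>k<n. cmod (char P (s * a k)))"
    by (simp add: char_law_S[OF assms] prod_norm)
  also have "\<dots> \<le> (\<Prod>k<n. exp (- ((\<integral>z. 1 - cos (s * a k * z) \<partial>law_sym P) / 2)))"
    by (intro prod_mono conjI cmod_char_le_exp assms) auto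
  also have "\<dots> = exp (- ((\<Sum>k<n. \<integral>z. 1 - cos (s * a k * z) \<partial>law_sym P) / 2))"
    by (simp add: exp_sum[symmetric] sum_negf sum_divide_distrib)
  also have "(\<Sum>k<n. \<integral>z. 1 - cos (s * a k * z) \<partial>law_sym P) = (\<integral>z. defect n a (s * z) \<partial>law_sym P)"
    unfolding defect_def by (subst Bochner_Integration.integral_sum[symmetric]) (use int in \<open>auto simp: mult_ac\<close>)
  finally show ?thesis .
qed

section \<open>Weighted Jensen inequality and Esseen-type inequality\<close>

text \<open>Jensen's inequality for \<open>exp (- f)\<close> under the probability weight
  \<open>w / M\<close>, where \<open>f = M / 2 * (g / w)\<close> has mean \<open>m\<close>. It is
  proved by integrating the tangent line of \<open>exp (- f)\<close> at \<open>m\<close>.\<close>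

lemma weighted_jensen_exp:
  fixes g w :: "real \<Rightarrow> real"
  assumes "real_distribution R"
    and [measurable]: "g \<in> borel_measurable borel" "w \<in> borel_measurable borel"
    and g: "\<And>z. 0 \<le> g z" "\<And>z. g z \<le> B" and w: "\<And>z. 0 \<le> w z" "\<And>z. w z \<le> 1" "\<And>z. w z = 0 \<Longrightarrow> g z = 0"
    and M: "M = (\<integral>z. w z \<partial>R)" "M > 0"
  shows "exp (- ((\<integral>z. g z \<partial>R) / 2)) \<le> (\<integral>z. w z / M * exp (- (M / 2 * (g z / w z))) \<partial>R)"
proof -
  interpret R: real_distribution R by fact
  define m where "m = (\<integral>z. g z \<partial>R) / 2"
  have gi: "integrable R g"
    using g by (intro R.integrable_const_bound[of _ B]) auto
  have wi: "integrable R w"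
    using w by (intro R.integrable_const_bound[of _ 1]) auto
  have "exp (- m) = (\<integral>z. exp (- m) * ((1 + m) * (w z / M) - g z / 2) \<partial>R)"
    using gi wi M by (simp add: m_def[symmetric])
  also have "\<dots> \<le> (\<integral>z. w z / M * exp (- (M / 2 * (g z / w z))) \<partial>R)"
  proof (rule integral_mono)
    show "integrable R (\<lambda>z. exp (- m) * ((1 + m) * (w z / M) - g z / 2))"
      using gi wi by simp
    show "integrable R (\<lambda>z. w z / M * exp (- (M / 2 * (g z / w z))))"
    proof (intro R.integrable_const_bound[of _ "1 / M"] AE_I2)
      fix z
      have "w z / M * exp (- (M / 2 * (g z / w z))) \<le> 1 / M * 1"
        using g w M by (intro mult_mono divide_right_mono) auto
      then show "norm (w z / M * exp (- (M / 2 * (g z / w z)))) \<le> 1 / M"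
        using w[of z] M by (simp add: abs_mult)
    qed simp
    fix z
    define f where "f = M / 2 * (g z / w z)"
    \<comment> \<open>Where \<open>w z = 0\<close> the quotient in \<open>f\<close> is
      \<open>0\<close> by convention, and both sides agree because \<open>g z\<close> vanishes there
      too.\<close>
    have "w z / M * f = g z / 2" using M w(3)[of z] by (cases "w z = 0") (auto simp: f_def)
    then have "exp (- m) * ((1 + m) * (w z / M) - g z / 2) = exp (- m) * ((1 + m) * (w z / M) - w z / M * f)"
      by simp
    also have "\<dots> = w z / M * (exp (- m) * (1 + (m - f)))"
      by (simp only: algebra_simps)
    also have "\<dots> \<le> w z / M * (exp (- m) * exp (m - f))"
      using w M by (intro mult_left_mono exp_ge_add_one_self) auto
    also have "exp (- m) * exp (m - f) = exp (- f)" by (simp add: mult_exp_exp)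
    finally show "exp (- m) * ((1 + m) * (w z / M) - g z / 2) \<le> w z / M * exp (- (M / 2 * (g z / w z)))"
      by (simp add: f_def)
  qed
  finally show ?thesis by (simp add: m_def)
qed

text \<open>Four times the cosine transform at \<open>D * (y - x)\<close> dominates the indicator of
  the interval: it is at least \<open>16/15\<close> inside and nonnegative outside. Fubini turns its
  \<open>F\<close>-integral into an average of real parts of a rotated
  \<open>char F (t * D)\<close>.\<close>

lemma esseen_kern:
  assumes "real_distribution F" "D > 0"
  shows "measure F {x..x + 1 / D} \<le> 4 * (\<integral>t. cmod (char F (t * D)) \<partial>kern)"
proof -
  interpret F: real_distribution F by fact
  interpret pair_sigma_finite kern F ..
  interpret KF: finite_measure "kern \<Otimes>\<^sub>M F"
    by (intro finite_measure_pair_measure kern.finite_measure_axioms F.finite_measure_axioms)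
  let ?k = "\<lambda>y. \<integral>t. cos (t * (D * (y - x))) \<partial>kern"
  have int: "integrable (kern \<Otimes>\<^sub>M F) (\<lambda>(t, y). cos (t * (D * (y - x))))"
    by (intro KF.integrable_const_bound[of _ 1]) auto
  have "measure F {x..x + 1 / D} = (\<integral>y. indicator {x..x + 1 / D} y \<partial>F)" by simp
  also have "\<dots> \<le> (\<integral>y. 4 * ?k y \<partial>F)"
  proof (rule integral_mono)
    show "integrable F (\<lambda>y. 4 * ?k y)"
      using integrable_snd[OF int] by simp
    fix y :: real
    show "indicator {x..x + 1 / D} y \<le> 4 * ?k y"
    proof (cases "y \<in> {x..x + 1 / D}")
      case True
      then have "0 \<le> D * (y - x)" "D * (y - x) \<le> 1"
        using \<open>D > 0\<close> by (auto simp: field_simps)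
      then show ?thesis using kern_cos_ge_small[of "D * (y - x)"] True by simp
    next
      case False
      then show ?thesis using kern_cos_nonneg[of "D * (y - x)"] by simp
    qed
  qed (simp add: F.emeasure_eq_measure)
  also have "\<dots> = 4 * (\<integral>t. (\<integral>y. cos (t * (D * (y - x))) \<partial>F) \<partial>kern)"
    using Fubini_integral[OF int] by simp
  also have "\<dots> \<le> 4 * (\<integral>t. cmod (char F (t * D)) \<partial>kern)"
  proof (intro mult_left_mono integral_mono)
    show "integrable kern (\<lambda>t. \<integral>y. cos (t * (D * (y - x))) \<partial>F)"
      using integrable_fst[OF int] by simp
    show "integrable kern (\<lambda>t. cmod (char F (t * D)))"
      using F.cmod_char_le_1 by (intro integrable_kern_bounded[of _ 1]) auto
    fix t :: real
    have i: "integrable F (\<lambda>y. iexp (t * D * y))"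
      by (rule F.integrable_iexp) auto
    have "(\<integral>y. cos (t * (D * (y - x))) \<partial>F) = (\<integral>y. Re (iexp (- (t * D * x)) * iexp (t * D * y)) \<partial>F)"
      by (simp add: mult_exp_exp Re_exp algebra_simps)
    also have "\<dots> = Re (\<integral>y. iexp (- (t * D * x)) * iexp (t * D * y) \<partial>F)"
      using i by (intro integral_Re) auto
    also have "\<dots> \<le> cmod (iexp (- (t * D * x)) * char F (t * D))"
      unfolding char_def by (subst integral_mult_right_zero) (rule complex_Re_le_cmod)
    also have "\<dots> = cmod (char F (t * D))"
      by (simp only: norm_mult norm_exp_i_times mult_1)
    finally show "(\<integral>y. cos (t * (D * (y - x))) \<partial>F) \<le> cmod (char F (t * D))" .
  qed simp
  finally show ?thesis .
qed

section \<open>Assembly of the concentration bound\<close>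

lemma concentration_bound:
  assumes P: "real_distribution P"
    and norm: "eucl_norm n a = 1" and "L > 0" "D > 0"
    and M: "Mfun P 1 > 0" "L\<^sup>2 \<ge> 1 / Mfun P 1"
    and dist: "\<And>(m::nat \<Rightarrow> int) t. 1 / (2 * supnorm n a) \<le> t \<Longrightarrow> t \<le> D \<Longrightarrow>
        eucl_norm n (\<lambda>k. t * a k - of_int (m k)) \<ge> fL L t"
  shows "measure (law_S n a P) {x..x + 1 / D} \<le> 384 * pi\<^sup>2 / (D * sqrt (Mfun P 1))"
proof -
  define R where "R = law_sym P"
  define M where "M = Mfun P 1"
  define w :: "real \<Rightarrow> real" where "w z = min (z\<^sup>2) 1" for z
  define h where "h t z = exp (- (M / 2 * (defect n a (t * D * z) / w z)))" for t z
  define C where "C = 96 * pi\<^sup>2 / (D * sqrt M)"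
  have M0: "M > 0" using M by (simp add: M_def)
  have Mw: "M = (\<integral>z. w z \<partial>R)" by (simp add: M_def Mfun_def R_def w_def)
  have [measurable]: "w \<in> borel_measurable borel" unfolding w_def[abs_def] by measurable
  have w: "0 \<le> w z" "w z \<le> 1" "w z = 0 \<Longrightarrow> z = 0" for z
    by (auto simp: w_def min_def split: if_splits)
  interpret R: real_distribution R
    unfolding R_def by (rule real_distribution_law_sym[OF P])
  interpret pair_sigma_finite kern R ..
  interpret KR: finite_measure "kern \<Otimes>\<^sub>M R"
    by (intro finite_measure_pair_measure kern.finite_measure_axioms R.finite_measure_axioms)
  have h: "0 \<le> h t z" "h t z \<le> 1" for t z
    using M0 w[of z] by (auto simp: h_def defect_nonneg)
  have wh: "0 \<le> w z / M * h t z" "w z / M * h t z \<le> 1 / M" for t z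
  proof -
    show "0 \<le> w z / M * h t z" using M0 w h by simp
    have "w z / M * h t z \<le> 1 / M * 1"
      using M0 w h by (intro mult_mono divide_right_mono) auto
    then show "w z / M * h t z \<le> 1 / M" by simp
  qed
  have int: "integrable (kern \<Otimes>\<^sub>M R) (\<lambda>(t, z). w z / M * h t z)"
  proof (intro KR.integrable_const_bound[of _ "1 / M"] AE_I2)
    show "(\<lambda>(t, z). w z / M * h t z) \<in> borel_measurable (kern \<Otimes>\<^sub>M R)"
      unfolding h_def by measurable
    show "norm (case p of (t, z) \<Rightarrow> w z / M * h t z) \<le> 1 / M" for p
      unfolding case_prod_beta real_norm_def using wh by (subst abs_of_nonneg) auto
  qed
  have wi: "integrable R w"
    using w by (intro R.integrable_const_bound[of _ 1]) auto
  have "measure (law_S n a P) {x..x + 1 / D} \<le> 4 * (\<integral>t. cmod (char (law_S n a P) (t * D)) \<partial>kern)"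
    by (intro esseen_kern real_distribution_law_S P \<open>D > 0\<close>)
  also have "\<dots> \<le> 4 * (\<integral>t. \<integral>z. w z / M * h t z \<partial>R \<partial>kern)"
  proof (intro mult_left_mono integral_mono)
    interpret S: real_distribution "law_S n a P" by (rule real_distribution_law_S[OF P])
    show "integrable kern (\<lambda>t. cmod (char (law_S n a P) (t * D)))"
      using S.cmod_char_le_1 by (intro integrable_kern_bounded[of _ 1]) auto
    show "integrable kern (\<lambda>t. \<integral>z. w z / M * h t z \<partial>R)"
      using integrable_fst[OF int] by simp
    fix t :: real
    have "cmod (char (law_S n a P) (t * D)) \<le> exp (- ((\<integral>z. defect n a (t * D * z) \<partial>R) / 2))"
      unfolding R_def by (rule cmod_char_law_S_le[OF P])
    also have "\<dots> \<le> (\<integral>z. w z / M * exp (- (M / 2 * (defect n a (t * D * z) / w z))) \<partial>R)"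
    proof (rule weighted_jensen_exp[OF R.real_distribution_axioms])
      show "w z = 0 \<Longrightarrow> defect n a (t * D * z) = 0" for z
        using w(3)[of z] by (simp add: defect_def)
    qed (use w M0 Mw defect_nonneg defect_le in auto)
    finally show "cmod (char (law_S n a P) (t * D)) \<le> (\<integral>z. w z / M * h t z \<partial>R)"
      by (simp add: h_def)
  qed simp
  also have "(\<integral>t. \<integral>z. w z / M * h t z \<partial>R \<partial>kern) = (\<integral>z. \<integral>t. w z / M * h t z \<partial>kern \<partial>R)"
    by (rule Fubini_integral[OF int, symmetric])
  \<comment> \<open>After the exchange of integrals the average over \<open>t\<close> is at most
    \<open>C\<close> for each \<open>z \<noteq> 0\<close>, and the weight vanishes at
    \<open>z = 0\<close>. Since \<open>w / M\<close> has total mass \<open>1\<close>, the outer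
    integral then returns \<open>C\<close>.\<close>
  also have "\<dots> \<le> (\<integral>z. w z / M * C \<partial>R)"
  proof (rule integral_mono)
    show "integrable R (\<lambda>z. \<integral>t. w z / M * h t z \<partial>kern)"
      using integrable_snd[OF int] by simp
    show "integrable R (\<lambda>z. w z / M * C)" using wi by simp
    fix z
    show "(\<integral>t. w z / M * h t z \<partial>kern) \<le> w z / M * C"
    proof (cases "z = 0")
      case False
      have "(\<integral>t. h t z \<partial>kern) \<le> C"
        unfolding h_def w_def C_def M_def
        by (rule kern_exp_defect_le[OF norm \<open>L > 0\<close> \<open>D > 0\<close> M dist False])
      then show ?thesis
        using w[of z] M0 by (simp add: mult_left_mono divide_right_mono)
    qed (simp add: w_def)
  qed
  also have "\<dots> = C" using wi M0 by (simp add: Mw[symmetric])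
  finally show ?thesis by (simp add: C_def M_def)
qed

theorem theorem1:
  shows "\<exists>c>0. \<forall>(n::nat) (a::nat \<Rightarrow> real) (P::real measure) (L::real) (D::real).
    prob_space P \<and> sets P = sets borel \<and>
    eucl_norm n a = 1 \<and> L > 0 \<and> D > 0 \<and>
    (\<forall>(m::nat \<Rightarrow> int) (t::real). 1 / (2 * supnorm n a) \<le> t \<and> t \<le> D \<longrightarrow>
        eucl_norm n (\<lambda>k. t * a k - of_int (m k)) \<ge> fL L t) \<and>
    Mfun P 1 > 0 \<and> L\<^sup>2 \<ge> 1 / Mfun P 1
    \<longrightarrow> Qconc (law_S n a P) (1 / D) \<le> c / (D * sqrt (Mfun P 1))"
\<comment> \<open>\<open>384\<close> is the \<open>4\<close> of \<open>esseen_kern\<close> times the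
  \<open>96\<close> of \<open>kern_exp_defect_le\<close>, itself \<open>4 * 24\<close> from scaling
  and the near case.\<close>
proof (intro exI[of _ "384 * pi\<^sup>2"] conjI allI impI)
  fix n a and P :: "real measure" and L D :: real
  assume *: "prob_space P \<and> sets P = sets borel \<and>
    eucl_norm n a = 1 \<and> L > 0 \<and> D > 0 \<and>
    (\<forall>(m::nat \<Rightarrow> int) (t::real). 1 / (2 * supnorm n a) \<le> t \<and> t \<le> D \<longrightarrow>
        eucl_norm n (\<lambda>k. t * a k - of_int (m k)) \<ge> fL L t) \<and>
    Mfun P 1 > 0 \<and> L\<^sup>2 \<ge> 1 / Mfun P 1"
  then have "real_distribution P"
    by (simp add: real_distribution_def real_distribution_axioms_def)
  then show "Qconc (law_S n a P) (1 / D) \<le> 384 * pi\<^sup>2 / (D * sqrt (Mfun P 1))"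
    unfolding Qconc_def using * by (intro cSUP_least concentration_bound[of P n a L]) auto
qed simp

end
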